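(* Let $C$ be a nonempty, closed, bounded, convex, weakly compact subset of a real Banach space $X$, and let $f:X\to\mathbb{R}$ be a convex, continuously Fréchet differentiable function whose Fréchet derivative $f':X\to X^*$ is uniformly continuous on $C$. Assume that $\min_{x\in C}f(x)$ is attained and put $f^*=\min_{x\in C}f(x)$. Let $\{x_k\}_{k\ge0}$ be a sequence generated by the Frank-Wolfe algorithm from an arbitrary $x_0\in C$, with each stepsize selected by line minimization search, i.e. $\gamma_k\in[0,1]$ is a minimizer of $\gamma\mapsto f(x_k+\gamma(\bar x_k-x_k))$ over $[0,1]$. Then (i) $f(x_{k+1})\le f(x_k)$ for all $k\ge0$; and (ii) $\lim_{k\to\infty}f(x_k)=f^*$.
   Context: $X^*$ is the dual of $X$ and $\langle x^*,x\rangle=x^*(x)$ is the duality pairing. Frank-Wolfe algorithm for $\min_{x\in C}f(x)$: given $x_0\in C$, for each $k\ge 0$ choose $\bar x_k\in C$ to be a minimizer of $x\mapsto\langle f'(x_k),x\rangle$ over $C$, and set $x_{k+1}=x_k+\gamma_k(\bar x_k-x_k)$, where $\gamma_k$ is the stepsize. *)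

theory Defs
  imports "HOL-Analysis.Analysis"
begin

definition weak_topology :: "'a::real_normed_vector topology" where
  "weak_topology =
     topology_generated_by {blinfun_apply \<phi> -` U | (\<phi> :: 'a \<Rightarrow>\<^sub>L real) U. open U}"

lemma topspace_weak_topology [simp]: "topspace (weak_topology :: 'a::real_normed_vector topology) = UNIV"
proof -
  have "UNIV \<in> {blinfun_apply \<phi> -` U | (\<phi> :: 'a \<Rightarrow>\<^sub>L real) U. open U}"
    by (rule CollectI, intro exI[of _ 0] exI[of _ UNIV]) auto
  then show ?thesis
    by (auto simp: weak_topology_def)
qed

lemma continuous_map_weak_topology:
  fixes \<phi> :: "'a::real_normed_vector \<Rightarrow>\<^sub>L real"
  shows "continuous_map weak_topology euclidean (blinfun_apply \<phi>)"
proof -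
  have "openin weak_topology (blinfun_apply \<phi> -` U)" if "open U" for U
    using that unfolding weak_topology_def by (intro topology_generated_by_Basis) blast
  then show ?thesis
    by (simp add: continuous_map_alt)
qed

definition weakly_compact :: "'a::real_normed_vector set \<Rightarrow> bool" where
  "weakly_compact C \<longleftrightarrow> compactin weak_topology C"

text \<open>The minimizers need not be unique, so the algorithm is a relation between the iterates
  \<open>x\<close>, the chosen minimizers \<open>xbar\<close> and the stepsizes \<open>\<gamma>\<close>; \<open>f'\<close> is the derivative of the
  objective function.\<close>

definition frank_wolfe ::
  "'a::real_normed_vector set \<Rightarrow> ('a \<Rightarrow> 'a \<Rightarrow>\<^sub>L real) \<Rightarrow> (nat \<Rightarrow> 'a) \<Rightarrow> (nat \<Rightarrow> 'a) \<Rightarrow> (nat \<Rightarrow> real) \<Rightarrow> bool"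
  where
  "frank_wolfe C f' x xbar \<gamma> \<longleftrightarrow>
     x 0 \<in> C \<and>
     (\<forall>k. is_arg_min (\<lambda>y. blinfun_apply (f' (x k)) y) (\<lambda>y. y \<in> C) (xbar k) \<and>
          x (Suc k) = x k + \<gamma> k *\<^sub>R (xbar k - x k))"

definition line_minimization ::
  "('a::real_normed_vector \<Rightarrow> real) \<Rightarrow> (nat \<Rightarrow> 'a) \<Rightarrow> (nat \<Rightarrow> 'a) \<Rightarrow> (nat \<Rightarrow> real) \<Rightarrow> bool"
  where
  "line_minimization f x xbar \<gamma> \<longleftrightarrow>
     (\<forall>k. is_arg_min (\<lambda>t. f (x k + t *\<^sub>R (xbar k - x k))) (\<lambda>t. t \<in> {0..1}) (\<gamma> k))"

end

theory Submission
  imports Defs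
begin

text \<open>Let \<open>h k = f (x k) - fstar\<close>. The tangent inequality at \<open>x k\<close> bounds \<open>h k\<close> by the
  Frank-Wolfe gap \<open>f' (x k) (x k - xbar k)\<close>. The tangent inequality at the \<^emph>\<open>new\<close> point
  \<open>y = x k + t (xbar k - x k)\<close> gives \<open>f y \<le> f (x k) + t f' y (xbar k - x k)\<close>, and replacing
  \<open>f' y\<close> by \<open>f' (x k)\<close> costs at most \<open>t e\<close> once \<open>t\<close> is small, uniformly in \<open>k\<close>. Line search is at
  least as good as the constant step \<open>t\<close>, so \<open>h (k + 1) \<le> (1 - t) h k + t e\<close>; in the limit of the
  decreasing sequence \<open>h\<close> this leaves at most \<open>e\<close>.\<close>

text \<open>Along the line \<open>w + t (z - w)\<close> the function \<open>f\<close> becomes a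
  convex function of one real variable with derivative \<open>D (z - w)\<close> at \<open>0\<close>,
  so the scalar tangent inequality at \<open>0\<close>, read off at \<open>1\<close>, gives the
  claim.\<close>

lemma convex_on_imp_above_tangent_blinfun:
  fixes f :: "'a::real_normed_vector \<Rightarrow> real"
  assumes cvx: "convex_on UNIV f"
    and deriv: "(f has_derivative blinfun_apply D) (at w)"
  shows "f w + D (z - w) \<le> f z"
proof -
  define \<phi> where "\<phi> = (\<lambda>t::real. f (w + t *\<^sub>R (z - w)))"
  have "convex_on UNIV \<phi>"
  proof (rule convex_onI)
    fix t a b :: real
    assume t: "0 < t" "t < 1"
    have "w + ((1 - t) *\<^sub>R a + t *\<^sub>R b) *\<^sub>R (z - w)
        = (1 - t) *\<^sub>R (w + a *\<^sub>R (z - w)) + t *\<^sub>R (w + b *\<^sub>R (z - w))"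
      by (simp add: algebra_simps)
    then show "\<phi> ((1 - t) *\<^sub>R a + t *\<^sub>R b) \<le> (1 - t) * \<phi> a + t * \<phi> b"
      using convex_onD[OF cvx, of t] t by (simp add: \<phi>_def)
  qed simp
  moreover have "(\<phi> has_real_derivative D (z - w)) (at 0 within UNIV)"
  proof -
    have "((\<lambda>t::real. w + t *\<^sub>R (z - w)) has_derivative (\<lambda>t. t *\<^sub>R (z - w))) (at 0)"
      by (auto intro!: derivative_eq_intros)
    moreover have "(f has_derivative D) (at (w + (0::real) *\<^sub>R (z - w)))"
      using deriv by simp
    ultimately have "(\<phi> has_derivative (\<lambda>t. D (t *\<^sub>R (z - w)))) (at 0)"
      unfolding \<phi>_def by (rule has_derivative_compose)
    then show ?thesis
      by (simp add: has_field_derivative_def blinfun.scaleR_right mult_commute_abs)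
  qed
  ultimately have "D (z - w) * (1 - 0) \<le> \<phi> 1 - \<phi> 0"
    by (intro convex_on_imp_above_tangent[where A = UNIV]) auto
  then show ?thesis
    by (simp add: \<phi>_def)
qed

lemma convex_line_segment_mem:
  assumes "convex C" "a \<in> C" "b \<in> C" "0 \<le> t" "t \<le> 1"
  shows "a + t *\<^sub>R (b - a) \<in> C"
  using convexD_alt[OF assms] by (simp add: algebra_simps)

text \<open>The modulus of uniform continuity of \<open>f'\<close> and the bound on \<open>C\<close>
  determine \<open>t\<close>; hence \<open>t\<close> depends on \<open>e\<close> but not on
  \<open>a\<close> and \<open>b\<close>, and one step serves all iterations at once.\<close>

lemma convex_step_decrease:
  fixes f :: "'a::real_normed_vector \<Rightarrow> real" and f' :: "'a \<Rightarrow> 'a \<Rightarrow>\<^sub>L real"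
  assumes "bounded C" and "convex C" and "convex_on UNIV f"
    and deriv: "\<And>y. (f has_derivative blinfun_apply (f' y)) (at y)"
    and "uniformly_continuous_on C f'"
    and "e > 0"
  obtains t where "0 < t" "t \<le> 1"
    "\<And>a b. a \<in> C \<Longrightarrow> b \<in> C \<Longrightarrow> f (a + t *\<^sub>R (b - a)) \<le> f a + t * f' a (b - a) + t * e"
proof -
  obtain B where B: "B > 0" "\<And>a. a \<in> C \<Longrightarrow> norm a \<le> B"
    using \<open>bounded C\<close> bounded_pos by blast
  have diam: "norm (b - a) \<le> 2 * B" if "a \<in> C" "b \<in> C" for a b
    using norm_triangle_ineq4[of b a] B(2)[OF that(1)] B(2)[OF that(2)] by linarith
  \<comment> \<open>Since \<open>2 * B\<close> bounds the diameter of \<open>C\<close>, this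
    tolerance for \<open>f'\<close> changes the slope along \<open>b - a\<close> by at most
    \<open>e\<close>.\<close>
  have "e / (2 * B) > 0"
    using \<open>e > 0\<close> B(1) by simp
  then obtain d where d: "d > 0"
    "\<And>a y. a \<in> C \<Longrightarrow> y \<in> C \<Longrightarrow> dist y a < d \<Longrightarrow> dist (f' y) (f' a) < e / (2 * B)"
    using \<open>uniformly_continuous_on C f'\<close> unfolding uniformly_continuous_on_def by metis
  \<comment> \<open>The cap \<open>1\<close> keeps the new point in \<open>C\<close>; the other
    bound moves it by at most \<open>d / 2\<close>, strictly less than \<open>d\<close>.\<close>
  define t where "t = min 1 (d / (4 * B))"
  have t: "0 < t" "t \<le> 1" "t * (2 * B) < d"
  proof -
    have "t * (2 * B) \<le> d / (4 * B) * (2 * B)"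
      using B(1) by (intro mult_right_mono) (auto simp: t_def)
    also have "\<dots> < d"
      using B(1) d(1) by simp
    finally show "t * (2 * B) < d" .
  qed (use B(1) d(1) in \<open>auto simp: t_def\<close>)
  have "f (a + t *\<^sub>R (b - a)) \<le> f a + t * f' a (b - a) + t * e" if ab: "a \<in> C" "b \<in> C" for a b
  proof -
    define y where "y = a + t *\<^sub>R (b - a)"
    have "y \<in> C"
      unfolding y_def using \<open>convex C\<close> ab t by (intro convex_line_segment_mem) auto
    have "dist y a = t * norm (b - a)"
      using t by (simp add: y_def dist_norm)
    also have "\<dots> \<le> t * (2 * B)"
      using t diam[OF ab] by (intro mult_left_mono) auto
    finally have close: "norm (f' y - f' a) \<le> e / (2 * B)"
      using d(2)[OF ab(1) \<open>y \<in> C\<close>] t(3) by (simp add: dist_norm)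
    have "(f' y - f' a) (b - a) \<le> norm (f' y - f' a) * norm (b - a)"
      using norm_blinfun[of "f' y - f' a" "b - a"] by simp
    also have "\<dots> \<le> e / (2 * B) * (2 * B)"
      using close diam[OF ab] B(1) \<open>e > 0\<close> by (intro mult_mono) auto
    also have "\<dots> = e"
      using B(1) by simp
    finally have "f' y (b - a) \<le> f' a (b - a) + e"
      by (simp add: blinfun.diff_left)
    then have "t * f' y (b - a) \<le> t * (f' a (b - a) + e)"
      using t by (intro mult_left_mono) auto
    \<comment> \<open>The tangent is taken at \<open>y\<close> and evaluated at \<open>a\<close>,
      which turns convexity into an upper bound for \<open>f y\<close>.\<close>
    moreover have "f y + f' y (a - y) \<le> f a"
      by (rule convex_on_imp_above_tangent_blinfun[OF \<open>convex_on UNIV f\<close> deriv])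
    moreover have "f' y (a - y) = - (t * f' y (b - a))"
      by (simp add: y_def blinfun.minus_right blinfun.scaleR_right)
    ultimately show ?thesis
      by (simp add: y_def algebra_simps)
  qed
  with t show thesis
    using that by blast
qed

theorem theorem3p2:
  fixes C :: "'a::banach set"
    and f :: "'a \<Rightarrow> real"
    and f' :: "'a \<Rightarrow> 'a \<Rightarrow>\<^sub>L real"
    and fstar :: real
    and x xbar :: "nat \<Rightarrow> 'a"
    and \<gamma> :: "nat \<Rightarrow> real"
  assumes "C \<noteq> {}" and "closed C" and "bounded C" and "convex C" and "weakly_compact C"
    and "convex_on UNIV f"
    and "\<And>y. (f has_derivative blinfun_apply (f' y)) (at y)"
    and "continuous_on UNIV f'"
    and "uniformly_continuous_on C f'"
    and "\<exists>z. is_arg_min f (\<lambda>y. y \<in> C) z"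
    and "fstar = (LEAST v. v \<in> f ` C)"
    and "frank_wolfe C f' x xbar \<gamma>"
    and "line_minimization f x xbar \<gamma>"
  shows "(\<forall>k. f (x (Suc k)) \<le> f (x k)) \<and> (\<lambda>k. f (x k)) \<longlonglongrightarrow> fstar"
proof -
  obtain z where z: "z \<in> C" "\<And>y. y \<in> C \<Longrightarrow> f z \<le> f y"
    using \<open>\<exists>z. is_arg_min f (\<lambda>y. y \<in> C) z\<close> by (auto simp: is_arg_min_linorder)
  have fstar: "fstar = f z"
    unfolding \<open>fstar = (LEAST v. v \<in> f ` C)\<close> using z by (intro Least_equality) auto
  have xbar: "xbar k \<in> C" "\<And>y. y \<in> C \<Longrightarrow> f' (x k) (xbar k) \<le> f' (x k) y"
    and step: "x (Suc k) = x k + \<gamma> k *\<^sub>R (xbar k - x k)" and "x 0 \<in> C" for k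
    using \<open>frank_wolfe C f' x xbar \<gamma>\<close> by (auto simp: frank_wolfe_def is_arg_min_linorder)
  have \<gamma>: "0 \<le> \<gamma> k" "\<gamma> k \<le> 1"
    and search: "\<And>t. 0 \<le> t \<Longrightarrow> t \<le> 1 \<Longrightarrow> f (x (Suc k)) \<le> f (x k + t *\<^sub>R (xbar k - x k))" for k
    using \<open>line_minimization f x xbar \<gamma>\<close>
    by (auto simp: line_minimization_def is_arg_min_linorder step)
  have xC: "x k \<in> C" for k
  proof (induction k)
    case (Suc k)
    then show ?case
      using convex_line_segment_mem[OF \<open>convex C\<close> Suc xbar(1) \<gamma>] by (simp add: step)
  qed (rule \<open>x 0 \<in> C\<close>)
  \<comment> \<open>The line search also competes with the step \<open>0\<close>, which stays at
    \<open>x k\<close>.\<close>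
  have decr: "f (x (Suc k)) \<le> f (x k)" for k
    using search[of 0 k] by simp
  then have "decseq (\<lambda>k. f (x k))"
    by (rule decseq_SucI)
  then obtain L where L: "(\<lambda>k. f (x k)) \<longlonglongrightarrow> L"
    using decseq_convergent[of "\<lambda>k. f (x k)" fstar] z(2)[OF xC] fstar by metis
  \<comment> \<open>By its choice, \<open>xbar k\<close> does at least as well as \<open>z\<close>
    in the linearized problem, and the tangent at \<open>x k\<close> lies below
    \<open>f z = fstar\<close>.\<close>
  have gap: "f' (x k) (xbar k - x k) \<le> fstar - f (x k)" for k
    using convex_on_imp_above_tangent_blinfun[OF \<open>convex_on UNIV f\<close> assms(7), of "x k" z]
      xbar(2)[OF z(1), of k] by (simp add: fstar blinfun.diff_right)
  have "L \<le> fstar + e" if "e > 0" for e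
  proof -
    obtain t where t: "0 < t" "t \<le> 1"
      "\<And>a b. a \<in> C \<Longrightarrow> b \<in> C \<Longrightarrow> f (a + t *\<^sub>R (b - a)) \<le> f a + t * f' a (b - a) + t * e"
      using convex_step_decrease[OF assms(3,4,6,7,9) \<open>e > 0\<close>] by metis
    have "f (x (Suc k)) \<le> f (x k) + t * (fstar - f (x k)) + t * e" for k
    proof -
      have "t * f' (x k) (xbar k - x k) \<le> t * (fstar - f (x k))"
        using gap t(1) by (intro mult_left_mono) auto
      then show ?thesis
        using search[of t k] t(1,2) t(3)[OF xC xbar(1), of k k] by linarith
    qed
    moreover have "(\<lambda>k. f (x (Suc k))) \<longlonglongrightarrow> L"
      using L by (rule LIMSEQ_Suc)
    moreover have "(\<lambda>k. f (x k) + t * (fstar - f (x k)) + t * e) \<longlonglongrightarrow> L + t * (fstar - L) + t * e"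
      by (intro tendsto_intros L)
    \<comment> \<open>Here \<open>t\<close> stays fixed while \<open>k\<close> tends to infinity;
      afterwards \<open>L\<close> cancels and the positive factor \<open>t\<close> can be divided
      out.\<close>
    ultimately have "L \<le> L + t * (fstar - L) + t * e"
      by (intro LIMSEQ_le) auto
    then have "0 \<le> t * (fstar + e - L)"
      by (simp add: algebra_simps)
    then show ?thesis
      using t(1) by (simp add: zero_le_mult_iff)
  qed
  then have "L \<le> fstar"
    by (rule field_le_epsilon)
  moreover have "fstar \<le> L"
    using L z(2)[OF xC] fstar by (intro LIMSEQ_le_const) auto
  ultimately show ?thesis
    using decr L by auto
qed

end
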